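(* There do not exist a prime $p$ and an integer $k\ge 2$ satisfying both $$\varphi(p^k+12)=\varphi(p^k)+12 \quad\text{and}\quad \sigma(p^k+12)=\sigma(p^k)+12.$$
   Context: $\varphi$ is Euler's totient function and $\sigma$ is the sum-of-divisors function on the positive integers. *)

theory Defs
  imports "HOL-Number_Theory.Totient"
begin

text \<open>Meaningful for positive arguments only: \<open>sum_divisors 0 = 0\<close>, as the sum then ranges over an
  infinite set.\<close>

definition sum_divisors :: "nat \<Rightarrow> nat" where
  "sum_divisors n = (\<Sum>d | d dvd n. d)"

end

theory Submission
  imports Defs
begin

text \<open>
  Put \<open>N = p\<^sup>k + 12\<close> and \<open>R = p\<^bsup>k - 1\<^esup>\<close>. The two equations give
  \<open>(p - 1) (N\<^sup>2 - \<phi>(N) \<sigma>(N)) = R (p - 13) + 12\<close>. Always \<open>\<phi>(N) \<sigma>(N) \<le> N\<^sup>2\<close>, which excludes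
  \<open>p < 13\<close>. For \<open>p \<ge> 13\<close>, the equation \<open>N - \<phi>(N) = R\<close> shows that \<open>N\<close> is neither prime nor divisible
  by the square of a prime. Hence \<open>N = q M\<close> with a prime \<open>q \<le> M\<close> not dividing \<open>M\<close>, and then
  \<open>N\<^sup>2 - \<phi>(N) \<sigma>(N) \<ge> M\<^sup>2 \<ge> N\<close>, which is too large.
\<close>

text \<open>For positive arguments, \<open>totient n / n\<close> is the product of
  \<open>1 - 1/p\<close> over the primes \<open>p\<close> dividing \<open>n\<close>. Passing from
  \<open>b\<close> to \<open>a * b\<close> only adds factors in \<open>[0, 1]\<close>.\<close>

lemma totient_mult_le: "totient (a * b) \<le> a * totient b"
proof (cases "a = 0 \<or> b = 0")
  case False
  define f where "f = (\<lambda>p. 1 - 1 / real p)"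
  have f: "0 \<le> f p \<and> f p \<le> 1" if "p \<in> prime_factors n" for p n :: nat
    using that prime_gt_0_nat[of p] by (auto simp: f_def in_prime_factors_iff)
  have sub: "prime_factors b \<subseteq> prime_factors (a * b)"
    using False by (intro dvd_prime_factors) auto
  have "prod f (prime_factors (a * b)) =
      prod f (prime_factors (a * b) - prime_factors b) * prod f (prime_factors b)"
    using sub by (intro prod.subset_diff) auto
  also have "\<dots> \<le> 1 * prod f (prime_factors b)"
    using f by (intro mult_right_mono prod_le_1 prod_nonneg) blast+
  finally have "real (a * b) * prod f (prime_factors (a * b)) \<le> real (a * b) * prod f (prime_factors b)"
    by (intro mult_left_mono) auto
  hence "real (totient (a * b)) \<le> real (a * totient b)"
    by (simp add: totient_formula2 f_def mult.assoc)
  thus ?thesis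
    by (simp only: of_nat_le_iff)
qed auto

text \<open>For \<open>d dvd n\<close> the previous bound gives
  \<open>totient n * d \<le> n * totient d\<close>. Sum over \<open>d\<close> and use that the
  totients of the divisors of \<open>n\<close> add up to \<open>n\<close>.\<close>

lemma totient_mult_sum_divisors_le: "totient n * sum_divisors n \<le> n\<^sup>2"
proof -
  have "totient n * d \<le> n * totient d" if "d dvd n" for d
    using that totient_mult_le[of "n div d" d] mult_le_mono1[of "totient n" _ d]
    by (fastforce simp: ac_simps elim!: dvdE)
  hence "(\<Sum>d | d dvd n. totient n * d) \<le> (\<Sum>d | d dvd n. n * totient d)"
    by (intro sum_mono) auto
  thus ?thesis
    by (simp add: sum_divisors_def totient_divisor_sum power2_eq_square flip: sum_distrib_left)
qed

text \<open>A divisor of \<open>q * m\<close> either divides \<open>m\<close> or is \<open>q\<close>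
  times a divisor of \<open>m\<close>. The two families may overlap, hence only an
  inequality.\<close>

lemma sum_divisors_prime_mult_le:
  assumes "prime q" "m > 0"
  shows "sum_divisors (q * m) \<le> (q + 1) * sum_divisors m"
proof -
  let ?D = "{d. d dvd m}"
  have fin: "finite ?D"
    using assms(2) by simp
  have "{d. d dvd q * m} \<subseteq> ?D \<union> (*) q ` ?D"
  proof
    fix d assume "d \<in> {d. d dvd q * m}"
    hence d: "d dvd q * m" by simp
    show "d \<in> ?D \<union> (*) q ` ?D"
    proof (cases "q dvd d")
      case True
      then show ?thesis
        using d assms prime_gt_0_nat by (auto elim!: dvdE)
    next
      case False
      hence "coprime d q"
        using assms(1) prime_imp_coprime[of q d] by (simp add: coprime_commute)
      thus ?thesis
        using d by (simp add: coprime_dvd_mult_right_iff)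
    qed
  qed
  hence "sum_divisors (q * m) \<le> \<Sum>(?D \<union> (*) q ` ?D)"
    unfolding sum_divisors_def using fin by (intro sum_mono2) auto
  also have "\<dots> \<le> \<Sum>?D + \<Sum>((*) q ` ?D)"
    using fin by (simp add: sum_Un_nat)
  also have "\<Sum>((*) q ` ?D) = q * \<Sum>?D"
    using assms(1) prime_gt_0_nat[of q]
    by (subst sum.reindex) (auto simp: inj_on_def sum_distrib_left)
  finally show ?thesis
    by (simp add: sum_divisors_def algebra_simps)
qed

text \<open>The prime \<open>q\<close> contributes at most \<open>(q - 1) * (q + 1)\<close>, one
  less than \<open>q\<^sup>2\<close>, and this deficit is multiplied by
  \<open>m\<^sup>2\<close>.\<close>

lemma totient_mult_sum_divisors_prime_mult_le:
  assumes "prime q" "m > 0" "\<not> q dvd m"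
  shows "totient (q * m) * sum_divisors (q * m) + m\<^sup>2 \<le> (q * m)\<^sup>2"
proof -
  have q: "q > 0" using assms(1) by (simp add: prime_gt_0_nat)
  have "totient (q * m) = (q - 1) * totient m"
    using assms by (simp add: totient_mult_coprime prime_imp_coprime totient_prime)
  hence "totient (q * m) * sum_divisors (q * m) \<le> (q - 1) * totient m * ((q + 1) * sum_divisors m)"
    using sum_divisors_prime_mult_le[OF assms(1,2)] by (metis mult_le_mono2)
  also have "\<dots> = (q - 1) * (q + 1) * (totient m * sum_divisors m)"
    by (simp only: ac_simps)
  also have "\<dots> \<le> (q - 1) * (q + 1) * m\<^sup>2"
    by (intro mult_left_mono totient_mult_sum_divisors_le) auto
  also have "\<dots> + m\<^sup>2 = (q * m)\<^sup>2"
    using q by (cases q) (auto simp: power2_eq_square algebra_simps)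
  finally show ?thesis by simp
qed

lemma sum_divisors_prime_power:
  assumes "prime p"
  shows "(p - 1) * sum_divisors (p ^ k) + 1 = p ^ Suc k"
proof -
  have p: "p > 1" using prime_gt_1_nat[OF assms] .
  have "{d. d dvd p ^ k} = (^) p ` {..k}"
    using divides_primepow_nat[OF assms] by auto
  hence "sum_divisors (p ^ k) = (\<Sum>i\<le>k. p ^ i)"
    using p by (simp add: sum_divisors_def sum.reindex inj_on_def)
  moreover have "int p ^ Suc k - 1 = (int p - 1) * (\<Sum>i\<le>k. int p ^ i)"
    using power_diff_1_eq[of "int p" "Suc k"] by (simp only: lessThan_Suc_atMost)
  ultimately have "int ((p - 1) * sum_divisors (p ^ k) + 1) = int (p ^ Suc k)"
    using p by (simp add: of_nat_diff)
  thus ?thesis by (simp only: of_nat_eq_iff)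
qed

text \<open>Take a prime factor \<open>q\<close> of the smaller factor \<open>a\<close> in a
  nontrivial factorization \<open>n = a * b\<close>; then \<open>q \<le> a \<le> b\<close>, and
  \<open>b\<close> divides the cofactor.\<close>

lemma not_prime_imp_prime_factor_le:
  fixes n :: nat
  assumes "\<not> prime n" "n > 1"
  obtains q m where "prime q" "n = q * m" "q \<le> m"
proof -
  obtain a b where ab: "n = a * b" "1 < a" "a \<le> b"
  proof -
    obtain a where a: "a dvd n" "a \<noteq> 1" "a \<noteq> n"
      using assms by (auto simp: prime_nat_iff)
    then obtain b where b: "n = a * b" by blast
    have "a > 1" "b > 1"
      using a b assms(2) by (auto intro!: Suc_lessI Nat.gr0I)
    thus thesis
      using that[of a b] that[of b a] b by (cases "a \<le> b") auto
  qed
  obtain q where q: "prime q" "q dvd a"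
    using ab(2) prime_factor_nat[of a] by auto
  then obtain c where c: "a = q * c" by blast
  have "c > 0" using c ab(2) by (intro Nat.gr0I) auto
  hence "b \<le> c * b" by simp
  moreover have "q \<le> a"
    using q(2) ab(2) by (intro dvd_imp_le) auto
  ultimately have "q \<le> c * b"
    using ab(3) by linarith
  thus thesis
    using that[of q "c * b"] q ab c by (simp add: ac_simps)
qed

theorem theorem3p1:
  shows "\<not> (\<exists>(p::nat) (k::nat). prime p \<and> k \<ge> 2 \<and>
    totient (p ^ k + 12) = totient (p ^ k) + 12 \<and>
    sum_divisors (p ^ k + 12) = sum_divisors (p ^ k) + 12)"
proof (rule notI, elim exE conjE)
  fix p k :: nat
  assume p: "prime p" and k: "k \<ge> 2"
    and t: "totient (p ^ k + 12) = totient (p ^ k) + 12"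
    and s: "sum_divisors (p ^ k + 12) = sum_divisors (p ^ k) + 12"
  define R where "R = p ^ (k - 1)"
  define N where "N = p ^ k + 12"
  have p1: "p > 1" using prime_gt_1_nat[OF p] .
  have pk: "p ^ k = p * R"
    using k by (cases k) (auto simp: R_def)
  have R: "R \<ge> p"
    using k p1 self_le_power[of p "k - 1"] by (simp add: R_def)
  have N: "N = p * R + 12"
    by (simp add: N_def pk)
  have "totient N = R * (p - 1) + 12"
    using t totient_prime_power[OF p, of k] k by (simp add: N_def R_def)
  hence tN: "totient N + R = N"
    using p1 unfolding N by (cases p) auto
  have tN': "int (totient N) = int p * int R - int R + 12"
    using tN unfolding N by (simp flip: of_nat_mult)
  have sN: "(p - 1) * sum_divisors N + 1 = p * (p * R) + 12 * (p - 1)"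
    using sum_divisors_prime_power[OF p, of k] by (simp add: N s[unfolded pk] pk add_mult_distrib2)
  have sN': "(int p - 1) * int (sum_divisors N) = int p * (int p * int R) + 12 * (int p - 1) - 1"
  proof -
    have "int ((p - 1) * sum_divisors N + 1) = int (p * (p * R) + 12 * (p - 1))"
      by (simp only: sN)
    thus ?thesis using p1 by (simp add: of_nat_diff)
  qed
  \<comment> \<open>The factor \<open>p - 1\<close> clears the denominator of the geometric sum.
    After expansion the terms in \<open>R\<^sup>2\<close> cancel, so the right side is only linear
    in \<open>R\<close>. Integers are used because it may be negative.\<close>
  have key: "(int p - 1) * ((int N)\<^sup>2 - int (totient N) * int (sum_divisors N))
      = int R * (int p - 13) + 12"
  proof -
    have "(int p - 1) * (int (totient N) * int (sum_divisors N)) =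
        int (totient N) * ((int p - 1) * int (sum_divisors N))"
      by (simp only: ac_simps)
    also have "\<dots> = (int p * int R - int R + 12) *
        (int p * (int p * int R) + 12 * (int p - 1) - 1)"
      by (simp only: sN' tN')
    finally show ?thesis
      by (simp add: N power2_eq_square algebra_simps)
  qed
  show False
  proof (cases "p < 13")
    case True
    \<comment> \<open>Since \<open>R \<ge> p\<close>, the negated right side of \<open>key\<close>
      is at least \<open>(p - 1) * (12 - p)\<close>; excluding the composite value 12 makes this
      strictly positive.\<close>
    have "p \<noteq> 12"
      using p prime_nat_iff[of p] by auto
    hence "0 < (int p - 1) * (12 - int p)"
      using True p1 by simp
    also have "\<dots> = int p * (13 - int p) - 12"
      by (simp add: algebra_simps)
    also have "\<dots> \<le> int R * (13 - int p) - 12"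
      using R True by (intro diff_right_mono mult_right_mono) auto
    finally have "(int p - 1) * ((int N)\<^sup>2 - int (totient N) * int (sum_divisors N)) < 0"
      using key by (simp add: algebra_simps)
    moreover have "int (totient N * sum_divisors N) \<le> int (N\<^sup>2)"
      using totient_mult_sum_divisors_le[of N] by (simp only: of_nat_le_iff)
    ultimately show False
      using p1 by (simp add: mult_less_0_iff)
  next
    case False
    \<comment> \<open>A prime \<open>N\<close> would have \<open>totient N = N - 1\<close>, forcing
      \<open>R = 1\<close>.\<close>
    have "\<not> prime N"
      using tN totient_prime[of N] R p1 by (auto simp: N)
    then obtain q m where qm: "prime q" "N = q * m" "q \<le> m"
      using not_prime_imp_prime_factor_le[of N] by (auto simp: N)
    \<comment> \<open>If \<open>q\<^sup>2\<close> divides \<open>N\<close>, then \<open>q\<close>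
      divides both \<open>N\<close> and \<open>totient N\<close>, hence their difference
      \<open>R\<close>, a power of \<open>p\<close>. So \<open>q = p\<close> divides 12, impossible
      for \<open>p \<ge> 13\<close>.\<close>
    have "\<not> q dvd m"
    proof
      assume "q dvd m"
      hence "q ^ 2 dvd N"
        by (simp add: qm(2) power2_eq_square)
      hence "totient (q ^ 2) dvd totient N"
        by (rule totient_dvd)
      hence "q dvd totient N"
        using qm(1) by (simp add: totient_prime_power dvd_mult_left)
      moreover have "q dvd totient N + R"
        using tN qm(2) by simp
      ultimately have "q dvd R"
        using dvd_add_right_iff by blast
      hence "q = p"
        using p qm(1) prime_dvd_power primes_dvd_imp_eq unfolding R_def by blast
      hence "p dvd p * R + 12"
        using qm(2) N by (metis dvd_triv_left)
      hence "p dvd 12"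
        by (simp add: dvd_add_right_iff)
      thus False
        using False dvd_imp_le[of p 12] by simp
    qed
    moreover have "m > 0"
      using qm prime_gt_0_nat[of q] by simp
    ultimately have "totient N * sum_divisors N + m\<^sup>2 \<le> N\<^sup>2"
      using totient_mult_sum_divisors_prime_mult_le qm by simp
    moreover have "N \<le> m\<^sup>2"
      using qm by (simp add: power2_eq_square)
    ultimately have "int (totient N * sum_divisors N + N) \<le> int (N\<^sup>2)"
      by (subst of_nat_le_iff) linarith
    hence "(int p - 1) * int N \<le> int R * (int p - 13) + 12"
      unfolding key[symmetric] using p1 by (intro mult_left_mono) auto
    \<comment> \<open>The gap between the two sides is exactly \<open>13 * R\<close>.\<close>
    moreover have "int R * (int p - 13) + 12 < int N"
      using R p1 by (simp add: N algebra_simps)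
    moreover have "1 * int N \<le> (int p - 1) * int N"
      using p1 by (intro mult_right_mono) auto
    ultimately show False by linarith
  qed
qed

end
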